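(* Let $\alpha_p,\alpha_q,\beta,\theta_p,\theta_q$ be real numbers with $$0<\alpha_p\le 2,\quad |\theta_p|\le\min\{\alpha_p,2-\alpha_p\},\qquad 0<\alpha_q\le 2,\quad |\theta_q|\le\min\{\alpha_q,2-\alpha_q\},\qquad 0<\beta\le 1,$$ and suppose that $\alpha_p=\beta\,\alpha_q$ and $\theta_p=\beta\,\theta_q$. Let $L_{\alpha_p}^{\theta_p}(x;t)$, $L_{\alpha_q}^{\theta_q}(x;t)$ and $L_\beta^{-\beta}(x;t)$ be the strictly stable densities with exponents $\alpha_p,\alpha_q,\beta$ and asymmetry parameters $\theta_p,\theta_q,-\beta$, respectively, evolving in time $t$. Then for all $0<x<\infty$ and $t>0$, $$L_{\alpha_p}^{\theta_p}(x;t)=\int_0^\infty L_{\alpha_q}^{\theta_q}(x;\tau)\,L_\beta^{-\beta}(\tau;t)\,d\tau .$$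
   Context: Strictly stable densities (Feller parameterization). For $0<\alpha\le 2$ and real $\theta$ with $|\theta|\le\min\{\alpha,2-\alpha\}$, $L_\alpha^\theta$ denotes the strictly stable probability density on $\mathbb R$ with characteristic function $$\int_{-\infty}^{+\infty}e^{i\kappa x}L_\alpha^\theta(x)\,dx=\exp\left[-\psi_\alpha^\theta(\kappa)\right],\qquad \psi_\alpha^\theta(\kappa)=|\kappa|^\alpha e^{i(\mathrm{sign}\,\kappa)\theta\pi/2},\quad \kappa\in\mathbb R .$$ The time-dependent density is, for $t>0$, $$L_\alpha^\theta(x;t):=t^{-1/\alpha}L_\alpha^\theta\left(\frac{x}{t^{1/\alpha}}\right).$$ For $0<\alpha<1$, $L_\alpha^{-\alpha}$ is supported in $[0,\infty)$ and has Laplace transform $\int_0^\infty e^{-sx}L_\alpha^{-\alpha}(x)\,dx=e^{-s^\alpha}$ for $\Re s>0$. Convention for degenerate cases: for $\alpha=1$, $\theta=\mp1$ the formula for the characteristic function gives the Dirac mass $L_1^{\mp1}(x)=\delta(x\mp1)$, so that $L_1^{\mp1}(x;t)=\delta(x\mp t)$; whenever one of the densities involved is of this kind, the identity is understood as an identity of measures in $x$ on $(0,\infty)$. *)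

theory Defs
  imports "HOL-Probability.Probability"
begin

definition feller_parameters :: "real \<Rightarrow> real \<Rightarrow> bool" where
  "feller_parameters \<alpha> \<theta> \<longleftrightarrow> 0 < \<alpha> \<and> \<alpha> \<le> 2 \<and> \<bar>\<theta>\<bar> \<le> min \<alpha> (2 - \<alpha>)"

definition stable_exponent :: "real \<Rightarrow> real \<Rightarrow> real \<Rightarrow> complex" where
  "stable_exponent \<alpha> \<theta> \<kappa> = of_real (\<bar>\<kappa>\<bar> powr \<alpha>) * exp (\<i> * of_real (sgn \<kappa> * \<theta> * pi / 2))"

definition strictly_stable_law :: "real \<Rightarrow> real \<Rightarrow> real measure \<Rightarrow> bool" where
  "strictly_stable_law \<alpha> \<theta> M \<longleftrightarrow>
     real_distribution M \<and> (\<forall>\<kappa>. char M \<kappa> = exp (- stable_exponent \<alpha> \<theta> \<kappa>))"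

text \<open>
  A density is determined by its characteristic function only up to null sets. Identities at
  every point refer to the continuous version, which is unique:
  see \<open>strictly_stable_density_unique\<close>.
\<close>

definition strictly_stable_density :: "real \<Rightarrow> real \<Rightarrow> (real \<Rightarrow> real) \<Rightarrow> bool" where
  "strictly_stable_density \<alpha> \<theta> L \<longleftrightarrow>
     continuous_on UNIV L \<and> (\<forall>x. 0 \<le> L x) \<and> strictly_stable_law \<alpha> \<theta> (density lborel L)"

lemma strictly_stable_density_unique:
  assumes "strictly_stable_density \<alpha> \<theta> L" "strictly_stable_density \<alpha> \<theta> L'"
  shows "L = L'"
proof
  fix x
  have cont: "continuous_on UNIV L" "continuous_on UNIV L'"
    and nonneg: "\<And>x. 0 \<le> L x" "\<And>x. 0 \<le> L' x"
    using assms by (auto simp: strictly_stable_density_def)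
  have meas: "L \<in> borel_measurable borel" "L' \<in> borel_measurable borel"
    using cont by (auto intro: borel_measurable_continuous_onI)
  have "density lborel L = density lborel L'"
    using assms unfolding strictly_stable_density_def strictly_stable_law_def
    by (intro Levy_uniqueness) auto
  then have "AE x in lborel. ennreal (L x) = ennreal (L' x)"
    using meas by (intro sigma_finite_measure.density_unique[OF sigma_finite_lborel]) auto
  then have "AE x in lborel. x \<in> {x. L x = L' x}"
    using nonneg by simp
  moreover have "closed {x. L x = L' x}"
    using cont by (intro closed_Collect_eq)
  ultimately show "L x = L' x"
    using mem_closed_if_AE_lebesgue[of "{x. L x = L' x}" x] AE_completion by blast
qed

definition density_at_time :: "real \<Rightarrow> (real \<Rightarrow> real) \<Rightarrow> real \<Rightarrow> real \<Rightarrow> real" where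
  "density_at_time \<alpha> L t x = t powr (- 1 / \<alpha>) * L (x / t powr (1 / \<alpha>))"

definition law_at_time :: "real \<Rightarrow> real measure \<Rightarrow> real \<Rightarrow> real measure" where
  "law_at_time \<alpha> M t = distr M borel (\<lambda>x. t powr (1 / \<alpha>) * x)"

text \<open>
  The only parameters for which the law is a point mass and has no density; see
  \<open>dirac_strictly_stable_law\<close> and \<open>dirac_law_at_time\<close> below.
\<close>

definition dirac_parameters :: "real \<Rightarrow> real \<Rightarrow> bool" where
  "dirac_parameters \<alpha> \<theta> \<longleftrightarrow> \<alpha> = 1 \<and> \<bar>\<theta>\<bar> = 1"

lemma dirac_strictly_stable_law:
  assumes "dirac_parameters \<alpha> \<theta>"
  shows "strictly_stable_law \<alpha> \<theta> M \<longleftrightarrow> M = return borel (- \<theta>)"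
proof -
  have R: "real_distribution (return borel (- \<theta>))"
    by (simp add: real_distribution_def real_distribution_axioms_def prob_space_return)
  have C: "char (return borel (- \<theta>)) \<kappa> = exp (- stable_exponent \<alpha> \<theta> \<kappa>)" for \<kappa>
  proof -
    have a: "\<alpha> = 1" "\<theta> = 1 \<or> \<theta> = -1"
      using assms by (auto simp: dirac_parameters_def abs_if split: if_splits)
    have e: "exp (\<i> * of_real (pi / 2)) = \<i>" "exp (- (\<i> * of_real (pi / 2))) = - \<i>"
      using cis_pi_half by (simp_all add: exp_minus cis_conv_exp)
    have "stable_exponent \<alpha> \<theta> \<kappa> = \<i> * of_real (\<theta> * \<kappa>)"
      using a e by (auto simp: stable_exponent_def sgn_if)
    moreover have "char (return borel (- \<theta>)) \<kappa> = exp (\<i> * of_real (- \<theta> * \<kappa>))"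
      by (simp add: char_def integral_return mult_ac)
    ultimately show ?thesis by simp
  qed
  show ?thesis
    unfolding strictly_stable_law_def
    using R C by (auto intro!: Levy_uniqueness)
qed

lemma dirac_law_at_time:
  assumes "dirac_parameters \<alpha> \<theta>" "strictly_stable_law \<alpha> \<theta> M" "0 < t"
  shows "law_at_time \<alpha> M t = return borel (- \<theta> * t)"
  using assms unfolding dirac_strictly_stable_law[OF assms(1)] law_at_time_def
  by (simp add: distr_return dirac_parameters_def mult.commute)

lemma law_at_time_density:
  assumes "L \<in> borel_measurable borel" "0 < t"
  shows "law_at_time \<alpha> (density lborel L) t = density lborel (density_at_time \<alpha> L t)"
proof -
  define c where "c = t powr (1 / \<alpha>)"
  have c: "c > 0" "t powr (- 1 / \<alpha>) = 1 / c"
    using assms(2) by (auto simp: c_def powr_minus_divide)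
  have "distr (density lborel L) borel (\<lambda>x. c * x)
      = distr (density lborel (\<lambda>x. ennreal (L ((c * x) / c)))) borel (\<lambda>x. c * x)"
    using c by simp
  also have "\<dots> = density (distr lborel borel (\<lambda>x. c * x)) (\<lambda>y. ennreal (L (y / c)))"
    using assms(1) by (subst density_distr) auto
  also have "distr lborel borel (\<lambda>x. c * x) = density lborel (\<lambda>_. ennreal (1 / c))"
    using lborel_distr_mult[of c] c(1) by (simp add: inverse_eq_divide)
  also have "density (density lborel (\<lambda>_. ennreal (1 / c))) (\<lambda>y. ennreal (L (y / c)))
      = density lborel (\<lambda>y. ennreal (density_at_time \<alpha> L t y))"
    using c assms(1)
    by (subst density_density_eq)
       (auto simp: density_at_time_def c(2) c_def[symmetric] ennreal_mult'[symmetric]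
          simp del: times_divide_eq_left)
  finally show ?thesis by (simp add: law_at_time_def c_def)
qed

end

theory Submission
  imports Defs "HOL-Complex_Analysis.Complex_Analysis"
begin

text \<open>
  Conditioning on the inner time, the mixture has characteristic function
  \<open>E exp (- T \<psi>\<^sub>q \<kappa>)\<close>, where \<open>T\<close> follows the one-sided law at time \<open>t\<close>; by the Laplace transform of that
  law this is \<open>exp (- t (\<psi>\<^sub>q \<kappa>) powr \<beta>) = exp (- t \<psi>\<^sub>p \<kappa>)\<close>. Hence the laws agree, and the densities agree
  almost everywhere. They agree at every \<open>x > 0\<close> because both sides are continuous there: integrating
  the Fourier integral by parts gives \<open>L x \<le> C / x\<close>, a bound that is invariant under the time scaling
  and so dominates the integrand locally uniformly in \<open>x\<close>.
\<close>

text \<open>Neither the support of the one-sided law nor its Laplace transform is given: a law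
  enters only through its characteristic function, that is, through boundary values on the imaginary
  axis. Both facts have to be extracted from there, the transform on the whole closed right
  half-plane, since this is where \<bar>\<theta>\<bar> \<le> 1 places the exponent.

  The pointwise claim meets a second obstacle at small inner times. The supremum of the density at
  time \<tau> grows like \<tau> powr (- 1 / \<alpha>), so domination by it would require a negative
  moment of the inner law. The bound by C / x trades this for keeping x away from 0. Its constant
  contains 1 / cos (\<theta> * pi / 2), which blows up as the parameters approach a point mass. For
  the degenerate parameters the identity of laws is already the claim, and the argument by
  characteristic functions covers them together with all others.\<close>

section \<open>Powers and real part of the stable exponent\<close>

text \<open>Since \<open>\<phi>\<close> stays within pi / 2 of 0, the principal logarithm of the
  exponent is \<open>of_real r + \<i> * of_real \<phi>\<close>, with no correction by a multiple of
  2 * pi, and the power multiplies modulus exponent and angle by the same factor \<beta>.\<close>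

lemma stable_exponent_powr:
  assumes "\<bar>\<theta>\<bar> \<le> 1"
  shows "stable_exponent \<alpha> \<theta> \<kappa> powr of_real \<beta> = stable_exponent (\<beta> * \<alpha>) (\<beta> * \<theta>) \<kappa>"
proof (cases "\<kappa> = 0")
  case True
  then show ?thesis by (simp add: stable_exponent_def)
next
  case False
  define \<phi> where "\<phi> = sgn \<kappa> * \<theta> * pi / 2"
  define r where "r = \<alpha> * ln \<bar>\<kappa>\<bar>"
  have "\<bar>sgn \<kappa> * \<theta>\<bar> \<le> 1"
    using assms False by (simp add: abs_mult abs_sgn_eq)
  then have "\<bar>sgn \<kappa> * \<theta>\<bar> * (pi / 2) \<le> 1 * (pi / 2)"
    by (intro mult_right_mono) auto
  then have "\<bar>\<phi>\<bar> \<le> pi / 2"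
    by (simp add: \<phi>_def abs_mult)
  then have \<phi>: "- pi < \<phi>" "\<phi> \<le> pi"
    using pi_gt_zero by linarith+
  have "stable_exponent \<alpha> \<theta> \<kappa> = exp (of_real r + \<i> * of_real \<phi>)"
    using False by (simp add: stable_exponent_def r_def \<phi>_def powr_def exp_add exp_of_real[symmetric])
  moreover have "Ln (exp (of_real r + \<i> * of_real \<phi>)) = of_real r + \<i> * of_real \<phi>"
    using \<phi> by (intro Ln_exp) auto
  ultimately have "stable_exponent \<alpha> \<theta> \<kappa> powr of_real \<beta>
      = exp (of_real \<beta> * (of_real r + \<i> * of_real \<phi>))"
    by (simp add: powr_def)
  also have "\<dots> = exp (of_real (\<beta> * r)) * exp (\<i> * of_real (\<beta> * \<phi>))"
    by (simp add: exp_add[symmetric] algebra_simps)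
  also have "\<dots> = stable_exponent (\<beta> * \<alpha>) (\<beta> * \<theta>) \<kappa>"
    using False by (simp add: stable_exponent_def r_def \<phi>_def powr_def exp_of_real[symmetric] mult_ac)
  finally show ?thesis .
qed

lemma Re_stable_exponent:
  "Re (stable_exponent \<alpha> \<theta> \<kappa>) = \<bar>\<kappa>\<bar> powr \<alpha> * cos (sgn \<kappa> * \<theta> * pi / 2)"
  by (simp add: stable_exponent_def Re_exp)

lemma Re_stable_exponent_nonneg:
  assumes "\<bar>\<theta>\<bar> \<le> 1"
  shows "0 \<le> Re (stable_exponent \<alpha> \<theta> \<kappa>)"
proof -
  have "\<bar>sgn \<kappa> * \<theta>\<bar> \<le> 1"
    using assms by (cases "\<kappa> = 0") (simp_all add: abs_mult abs_sgn_eq)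
  then have "\<bar>sgn \<kappa> * \<theta>\<bar> * (pi / 2) \<le> 1 * (pi / 2)"
    by (intro mult_right_mono) auto
  then have "\<bar>sgn \<kappa> * \<theta> * pi / 2\<bar> \<le> pi / 2"
    by (simp add: abs_mult)
  then have "0 \<le> cos (sgn \<kappa> * \<theta> * pi / 2)"
    unfolding abs_le_iff by (intro cos_ge_zero) linarith+
  then show ?thesis by (simp add: Re_stable_exponent)
qed

text \<open>The one-sided parameters (\<beta>, - \<beta>) are \<beta> times (1, - 1). With
  \<open>stable_exponent_powr\<close> this makes the characteristic function of the one-sided law at
  \<kappa> equal to \<open>exp (- (s powr \<beta>))\<close> at the imaginary point s = - \<i> *
  \<kappa>.\<close>

lemma stable_exponent_one: "stable_exponent 1 (- 1) \<kappa> = - (\<i> * of_real \<kappa>)"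
proof -
  have "exp (- (\<i> * of_real pi / 2)) = - \<i>" "exp (\<i> * of_real pi / 2) = \<i>"
    using cis_pi_half by (simp_all add: exp_minus cis_conv_exp)
  then show ?thesis by (auto simp: stable_exponent_def sgn_if)
qed

lemma feller_abs_le_1: "feller_parameters \<alpha> \<theta> \<Longrightarrow> \<bar>\<theta>\<bar> \<le> 1"
  by (auto simp: feller_parameters_def)

text \<open>The bound \<open>min \<alpha> (2 - \<alpha>)\<close> reaches 1 only at \<alpha> = 1.
  Strictness gives \<open>0 < cos (\<theta> * pi / 2)\<close>, hence exponential decay of the
  characteristic function.\<close>

lemma feller_abs_less_1:
  "feller_parameters \<alpha> \<theta> \<Longrightarrow> \<not> dirac_parameters \<alpha> \<theta> \<Longrightarrow> \<bar>\<theta>\<bar> < 1"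
  by (auto simp: feller_parameters_def dirac_parameters_def)

section \<open>Laplace transforms of a law restricted to a set\<close>

text \<open>The absolute value lets the positive and the negative half-line be treated alike: both
  transforms live on the right half-plane, where the integrand has norm at most 1.\<close>

definition partial_laplace :: "real measure \<Rightarrow> real set \<Rightarrow> complex \<Rightarrow> complex" where
  "partial_laplace M A s = (CLINT x|M. indicator A x *\<^sub>R exp (- (s * of_real \<bar>x\<bar>)))"

context real_distribution
begin

lemma integrable_partial_laplace:
  assumes [measurable]: "A \<in> sets borel" and "0 \<le> Re s"
  shows "integrable M (\<lambda>x. indicator A x *\<^sub>R exp (- (s * of_real \<bar>x\<bar>)))"
  using assms(2)
  by (intro integrable_const_bound[where B = 1])
     (auto simp: norm_exp_eq_Re indicator_def intro!: AE_I2)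

lemma norm_partial_laplace_le:
  assumes "0 \<le> Re s"
  shows "norm (partial_laplace M A s) \<le> 1"
proof (cases "integrable M (\<lambda>x. indicator A x *\<^sub>R exp (- (s * of_real \<bar>x\<bar>)))")
  case True
  have "norm (partial_laplace M A s)
      \<le> (\<integral>x. norm (indicator A x *\<^sub>R exp (- (s * of_real \<bar>x\<bar>))) \<partial>M)"
    unfolding partial_laplace_def by (rule integral_norm_bound)
  also have "\<dots> \<le> (\<integral>x. 1 \<partial>M)"
    using assms by (intro integral_mono[OF integrable_norm[OF True]])
      (auto simp: norm_exp_eq_Re indicator_def)
  finally show ?thesis by (simp add: prob_space del: space_eq_univ)
qed (simp add: partial_laplace_def not_integrable_integral_eq)

lemma continuous_on_partial_laplace:
  assumes [measurable]: "A \<in> sets borel"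
  shows "continuous_on {s. 0 \<le> Re s} (partial_laplace M A)"
  unfolding continuous_on_sequentially
proof safe
  fix X s assume X: "\<forall>n. X n \<in> {s. 0 \<le> Re s}" "X \<longlonglongrightarrow> s" "0 \<le> Re s"
  show "(partial_laplace M A \<circ> X) \<longlonglongrightarrow> partial_laplace M A s"
    unfolding comp_def partial_laplace_def using X(1)
    by (intro integral_dominated_convergence[where w="\<lambda>_. 1"])
       (auto intro!: tendsto_intros X simp: norm_exp_eq_Re indicator_def)
qed

text \<open>Differentiation under the integral sign. The law may lack a first moment, but at
  distance r from the imaginary axis u \<le> exp u gives
  \<open>\<bar>x\<bar> * exp (- (r * \<bar>x\<bar>)) \<le> 1 / r\<close>, so a constant
  dominates.\<close>

lemma partial_laplace_holomorphic:
  assumes [measurable]: "A \<in> sets borel"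
  shows "partial_laplace M A holomorphic_on {s. 0 < Re s}"
proof -
  have "\<exists>D. (partial_laplace M A has_field_derivative D) (at s)" if s: "0 < Re s" for s
  proof
    define r where "r = Re s / 2"
    have r: "0 < r" "r < Re s" using s by (auto simp: r_def)
    define S where "S = {z. r < Re z}"
    have S: "open S" "convex S" "s \<in> S"
      using r by (auto simp: S_def open_halfspace_Re_gt convex_halfspace_Re_gt)
    let ?f = "\<lambda>z x. indicator A x *\<^sub>R exp (- (z * of_real \<bar>x\<bar>)) :: complex"
    let ?f' = "\<lambda>z x. indicator A x *\<^sub>R (- (of_real \<bar>x\<bar> * exp (- (z * of_real \<bar>x\<bar>)))) :: complex"
    have deriv: "((\<lambda>z. ?f z x) has_field_derivative ?f' z x) (at z within T)" for z x T
      by (auto intro!: derivative_eq_intros simp: indicator_def)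
    have bd: "norm (?f' z x) \<le> 1 / r" if "z \<in> S" for z x
    proof -
      have "r * \<bar>x\<bar> * exp (- (Re z * \<bar>x\<bar>)) \<le> r * \<bar>x\<bar> * exp (- (r * \<bar>x\<bar>))"
        using that r by (intro mult_left_mono) (auto simp: S_def intro!: mult_right_mono)
      also have "\<dots> \<le> exp (r * \<bar>x\<bar>) * exp (- (r * \<bar>x\<bar>))"
        using exp_ge_add_one_self[of "r * \<bar>x\<bar>"] by (intro mult_right_mono) (linarith | simp)+
      finally have "r * (\<bar>x\<bar> * exp (- (Re z * \<bar>x\<bar>))) \<le> 1" by (simp add: exp_minus mult_ac)
      then show ?thesis
        using r by (simp add: indicator_def norm_mult norm_exp_eq_Re field_simps)
    qed
    \<comment> \<open>The mean value inequality on the convex set \<open>S\<close> carries the bound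
      over from the derivative to the difference quotients, to which dominated convergence is
      applied.\<close>
    have lip: "norm ((?f y x - ?f s x) / (y - s)) \<le> 1 / r" if y: "y \<in> S - {s}" for x y
    proof -
      have "norm (?f y x - ?f s x) \<le> 1 / r * norm (y - s)"
        using S y by (intro field_differentiable_bound[OF \<open>convex S\<close> deriv bd]) auto
      then show ?thesis using y by (simp add: norm_divide divide_le_eq)
    qed
    have "((\<lambda>y. (partial_laplace M A y - partial_laplace M A s) / (y - s))
        \<longlongrightarrow> (CLINT x|M. ?f' s x)) (at s within S)"
      unfolding tendsto_at_iff_sequentially
    proof safe
      fix X :: "nat \<Rightarrow> complex" assume X: "\<forall>i. X i \<in> S - {s}" "X \<longlonglongrightarrow> s"
      have int: "integrable M (?f z)" if "z \<in> S" for z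
        using that r by (intro integrable_partial_laplace) (auto simp: S_def)
      have eq: "(partial_laplace M A (X i) - partial_laplace M A s) / (X i - s)
          = (CLINT x|M. (?f (X i) x - ?f s x) / (X i - s))" for i
        using X(1) S int by (simp add: partial_laplace_def)
      have lim: "(\<lambda>i. (?f (X i) x - ?f s x) / (X i - s)) \<longlonglongrightarrow> ?f' s x" for x
        using deriv[of x s S, unfolded has_field_derivative_iff tendsto_at_iff_sequentially] X
        by (auto simp: comp_def)
      show "((\<lambda>y. (partial_laplace M A y - partial_laplace M A s) / (y - s)) \<circ> X)
          \<longlonglongrightarrow> (CLINT x|M. ?f' s x)"
        unfolding comp_def eq
      proof (rule integral_dominated_convergence[where w = "\<lambda>_. 1 / r"])
        show "AE x in M. (\<lambda>i. (?f (X i) x - ?f s x) / (X i - s)) \<longlonglongrightarrow> ?f' s x"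
          using lim by (intro AE_I2)
        show "AE x in M. norm ((?f (X i) x - ?f s x) / (X i - s)) \<le> 1 / r" for i
          using lip X(1) by (intro AE_I2) blast
      qed auto
    qed
    then show "(partial_laplace M A has_field_derivative (CLINT x|M. ?f' s x)) (at s)"
      using S at_within_open[of s S] by (simp add: has_field_derivative_iff)
  qed
  then show ?thesis
    unfolding holomorphic_on_def field_differentiable_def
    using DERIV_subset[OF _ subset_UNIV] by blast
qed

text \<open>An atom at 0 would survive in the limit. For the negative half-line this limit later
  fixes the constant supplied by Liouville's theorem.\<close>

lemma partial_laplace_tendsto_0:
  assumes [measurable]: "A \<in> sets borel" and "0 \<notin> A"
  shows "(\<lambda>n. partial_laplace M A (of_nat n)) \<longlonglongrightarrow> 0"
proof -
  have "(\<lambda>n. CLINT x|M. indicator A x *\<^sub>R exp (- (of_nat n * of_real \<bar>x\<bar>))) \<longlonglongrightarrow> (CLINT x|M. 0)"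
  proof (rule integral_dominated_convergence[where w = "\<lambda>_. 1"])
    show "AE x in M. (\<lambda>n. indicator A x *\<^sub>R exp (- (of_nat n * complex_of_real \<bar>x\<bar>))) \<longlonglongrightarrow> 0"
    proof (intro AE_I2)
      fix x :: real
      show "(\<lambda>n. indicator A x *\<^sub>R exp (- (of_nat n * complex_of_real \<bar>x\<bar>))) \<longlonglongrightarrow> 0"
      proof (cases "x \<in> A")
        case True
        then have "x \<noteq> 0" using assms by auto
        then have "norm (exp (- complex_of_real \<bar>x\<bar>)) < 1" by (simp add: norm_exp_eq_Re)
        then have "(\<lambda>n. exp (- complex_of_real \<bar>x\<bar>) ^ n) \<longlonglongrightarrow> 0"
          by (rule LIMSEQ_power_zero)
        then show ?thesis using True by (simp add: exp_of_nat_mult[symmetric])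
      qed simp
    qed
  qed (auto simp: norm_exp_eq_Re indicator_def)
  then show ?thesis by (simp add: partial_laplace_def)
qed

end

section \<open>Support and Laplace transform of the one-sided law\<close>

lemma strictly_stable_law_real_distribution:
  "strictly_stable_law \<alpha> \<theta> M \<Longrightarrow> real_distribution M"
  by (simp add: strictly_stable_law_def)

lemma (in real_distribution) char_eq_partial_laplace:
  "char M \<kappa> = partial_laplace M {0..} (- (\<i> * of_real \<kappa>)) + partial_laplace M {..<0} (\<i> * of_real \<kappa>)"
proof -
  have "char M \<kappa> = (CLINT x|M. indicator {0..} x *\<^sub>R exp (- (- (\<i> * of_real \<kappa>) * of_real \<bar>x\<bar>))
      + indicator {..<0} x *\<^sub>R exp (- (\<i> * of_real \<kappa> * of_real \<bar>x\<bar>)))"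
    unfolding char_def by (intro Bochner_Integration.integral_cong) (auto simp: indicator_def mult_ac)
  also have "\<dots> = partial_laplace M {0..} (- (\<i> * of_real \<kappa>))
      + partial_laplace M {..<0} (\<i> * of_real \<kappa>)"
    unfolding partial_laplace_def
    by (intro Bochner_Integration.integral_add integrable_partial_laplace) auto
  finally show ?thesis .
qed

text \<open>
  On the imaginary axis the Laplace transform of the positive part differs from
  \<open>exp (- s powr \<beta>)\<close> by the transform of the negative part, which extends to the left half-plane.
  The two pieces glue to a bounded entire function, which tends to 0 at \<open>-\<infinity>\<close>.
\<close>

lemma one_sided_law_partial_laplace:
  assumes "strictly_stable_law \<beta> (- \<beta>) M" "0 < \<beta>" "\<beta> \<le> 1"
  shows "0 \<le> Re s \<Longrightarrow> partial_laplace M {0..} s = exp (- (s powr of_real \<beta>))"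
    and "partial_laplace M {..<0} 1 = 0"
proof -
  interpret real_distribution M
    using assms(1) by (rule strictly_stable_law_real_distribution)
  define f where "f s = exp (- (s powr of_real \<beta>)) - partial_laplace M {0..} s" for s
  define g where "g s = partial_laplace M {..<0} (- s)" for s
  define h where "h s = (if 0 \<le> Re s then f s else g s)" for s
  have eq: "f s = g s" if "Re s = 0" for s
  proof -
    have s: "s = - (\<i> * of_real (- Im s))"
      using that by (simp add: complex_eq_iff)
    have "char M (- Im s) = exp (- (s powr of_real \<beta>))"
      using assms(1) stable_exponent_powr[of "-1" 1 "- Im s" \<beta>] stable_exponent_one[of "- Im s"]
        s[symmetric] by (simp add: strictly_stable_law_def)
    moreover have "char M (- Im s) = partial_laplace M {0..} s + g s"
      using char_eq_partial_laplace[of "- Im s"] s[symmetric]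
      by (simp add: g_def minus_equation_iff)
    ultimately show ?thesis
      unfolding f_def by (metis add_diff_cancel_left')
  qed
  have f_cont: "continuous_on {s. 0 \<le> Re s} f"
    unfolding f_def using assms
    by (intro continuous_intros continuous_on_partial_laplace) auto
  have g_cont: "continuous_on {s. Re s \<le> 0} g"
    unfolding g_def
    by (intro continuous_on_compose2[OF continuous_on_partial_laplace] continuous_intros) auto
  have "h holomorphic_on UNIV"
  \<comment> \<open>Continuity across the line suffices for pasting. Nothing better is known on the
    imaginary axis, where the transforms are mere boundary values and the power may be singular at
    0.\<close>
  proof (rule holomorphic_on_paste_across_line[of UNIV 1 _ 0])
    have "f holomorphic_on {z. 0 < Re z}"
      unfolding f_def
      by (intro holomorphic_intros partial_laplace_holomorphic)
         (auto simp: complex_nonpos_Reals_iff)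
    then show "h holomorphic_on UNIV \<inter> {z. 0 < 1 \<bullet> z}"
      by (rule holomorphic_transform[OF holomorphic_on_subset])
         (auto simp: h_def inner_complex_def)
    have "g holomorphic_on {z. Re z < 0}"
      unfolding g_def
      by (intro holomorphic_on_compose_gen[OF _ partial_laplace_holomorphic, unfolded o_def]
            holomorphic_intros) auto
    then show "h holomorphic_on UNIV \<inter> {z. 1 \<bullet> z < 0}"
      by (rule holomorphic_transform[OF holomorphic_on_subset])
         (auto simp: h_def inner_complex_def)
    have "continuous_on ({s. 0 \<le> Re s} \<union> {s. Re s \<le> 0}) h"
      unfolding h_def using f_cont g_cont eq
      by (intro continuous_on_cases closed_halfspace_Re_ge closed_halfspace_Re_le) auto
    moreover have "{s. 0 \<le> Re s} \<union> {s. Re s \<le> 0} = UNIV" by auto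
    ultimately show "continuous_on UNIV h" by simp
  qed auto
  moreover have "bounded (range h)"
  proof (rule boundedI)
    fix z assume "z \<in> range h"
    then obtain s where z: "z = h s" by auto
    show "norm z \<le> 2"
    proof (cases "0 \<le> Re s")
      case True
      \<comment> \<open>Here \<beta> \<le> 1 enters: the power shrinks the angle of s and keeps it
        in the closed right half-plane.\<close>
      have "0 \<le> Re (s powr of_real \<beta>)"
      proof (cases "s = 0")
        case False
        have "\<bar>Im (Ln s)\<bar> \<le> pi / 2"
          using Re_Ln_pos_le[OF False] True by simp
        then have "\<beta> * \<bar>Im (Ln s)\<bar> \<le> 1 * (pi / 2)"
          using assms by (intro mult_mono) auto
        then have "\<bar>\<beta> * Im (Ln s)\<bar> \<le> pi / 2"
          using assms by (simp add: abs_mult)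
        then have "0 \<le> cos (\<beta> * Im (Ln s))"
          unfolding abs_le_iff by (intro cos_ge_zero) linarith+
        then show ?thesis using False by (simp add: powr_def Re_exp)
      qed simp
      then have "norm (f s) \<le> 1 + 1"
        unfolding f_def using norm_partial_laplace_le[OF True]
        by (intro norm_triangle_le_diff add_mono) (auto simp: norm_exp_eq_Re)
      then show ?thesis using True by (simp add: z h_def)
    next
      case False
      then show ?thesis
        using norm_partial_laplace_le[of "- s" "{..<0}"] by (simp add: z h_def g_def)
    qed
  qed
  ultimately obtain c where c: "\<And>z. h z = c"
    using Liouville_theorem[of h] by (auto simp: constant_on_def)
  have "(\<lambda>n. partial_laplace M {..<0} (of_nat n)) \<longlonglongrightarrow> 0"
    by (rule partial_laplace_tendsto_0) auto
  moreover have "partial_laplace M {..<0} (of_nat n) = c" for n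
  proof (cases "n = 0")
    \<comment> \<open>The point 0 belongs to the branch \<open>f\<close> of \<open>h\<close>, so the
      value of \<open>g\<close> there is reached through \<open>eq\<close>.\<close>
    case True
    then show ?thesis using c[of 0] eq[of 0] by (simp add: h_def g_def)
  next
    case False
    then show ?thesis using c[of "- of_nat n"] by (simp add: h_def g_def)
  qed
  ultimately have "c = 0" by (simp add: LIMSEQ_const_iff)
  then show "0 \<le> Re s \<Longrightarrow> partial_laplace M {0..} s = exp (- (s powr of_real \<beta>))"
    using c[of s] by (simp add: h_def f_def)
  show "partial_laplace M {..<0} 1 = 0"
    using c[of "-1"] \<open>c = 0\<close> by (simp add: h_def g_def)
qed

text \<open>The transform of the negative part at s = 1 integrates a strictly positive weight over
  the negative half-line; as it vanishes, the half-line is a null set.\<close>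

lemma one_sided_law_AE_nonneg:
  assumes "strictly_stable_law \<beta> (- \<beta>) M" "0 < \<beta>" "\<beta> \<le> 1"
  shows "AE x in M. 0 \<le> x"
proof -
  interpret real_distribution M
    using assms(1) by (rule strictly_stable_law_real_distribution)
  let ?f = "\<lambda>x::real. indicator {..<0} x * exp (- \<bar>x\<bar>) :: real"
  have "complex_of_real (\<integral>x. ?f x \<partial>M) = (CLINT x|M. of_real (?f x))"
    by (rule integral_complex_of_real[symmetric])
  also have "\<dots> = partial_laplace M {..<0} 1"
    unfolding partial_laplace_def
    by (intro Bochner_Integration.integral_cong) (auto simp: indicator_def exp_of_real[symmetric])
  also have "\<dots> = 0"
    by (rule one_sided_law_partial_laplace[OF assms])
  finally have "(\<integral>x. ?f x \<partial>M) = 0" by simp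
  moreover have "integrable M ?f"
    by (intro integrable_const_bound[where B = 1]) (auto simp: indicator_def intro!: AE_I2)
  ultimately have "AE x in M. ?f x = 0"
    by (subst (asm) integral_nonneg_eq_0_iff_AE) (auto simp: indicator_def)
  then show ?thesis by eventually_elim (auto simp: indicator_def split: if_splits)
qed

lemma one_sided_law_laplace:
  assumes "strictly_stable_law \<beta> (- \<beta>) M" "0 < \<beta>" "\<beta> \<le> 1" and "0 \<le> Re s"
  shows "(CLINT x|M. exp (- (s * of_real \<bar>x\<bar>))) = exp (- (s powr of_real \<beta>))"
proof -
  interpret real_distribution M
    using assms(1) by (rule strictly_stable_law_real_distribution)
  have "(CLINT x|M. exp (- (s * of_real \<bar>x\<bar>))) = partial_laplace M {0..} s"
    unfolding partial_laplace_def
    using one_sided_law_AE_nonneg[OF assms(1-3)] by (intro integral_cong_AE) (auto simp: indicator_def)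
  then show ?thesis
    using one_sided_law_partial_laplace(1)[OF assms] by simp
qed

section \<open>Laws at time t and mixtures over a random time\<close>

text \<open>Time 0 is included because the inner law is only shown to live on \<open>{0..}\<close>.
  As 0 powr (1 / \<alpha>) = 0, the law at time 0 is the point mass at 0.\<close>

lemma stable_exponent_scale:
  assumes "0 \<le> t" "0 < \<alpha>"
  shows "stable_exponent \<alpha> \<theta> (t powr (1 / \<alpha>) * \<kappa>) = of_real t * stable_exponent \<alpha> \<theta> \<kappa>"
proof (cases "t = 0")
  case False
  then have "\<bar>t powr (1 / \<alpha>) * \<kappa>\<bar> powr \<alpha> = t * \<bar>\<kappa>\<bar> powr \<alpha>"
    using assms by (simp add: abs_mult powr_mult powr_powr)
  moreover have "sgn (t powr (1 / \<alpha>) * \<kappa>) = sgn \<kappa>"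
    using False assms by (simp add: sgn_mult)
  ultimately show ?thesis by (simp add: stable_exponent_def)
qed (simp add: stable_exponent_def)

lemma real_distribution_law_at_time:
  assumes "real_distribution M"
  shows "real_distribution (law_at_time \<alpha> M t)"
proof -
  interpret real_distribution M by fact
  show ?thesis
    unfolding law_at_time_def by (intro real_distribution_distr) simp
qed

lemma char_law_at_time:
  assumes "strictly_stable_law \<alpha> \<theta> M" "0 \<le> t" "0 < \<alpha>"
  shows "char (law_at_time \<alpha> M t) \<kappa> = exp (- (of_real t * stable_exponent \<alpha> \<theta> \<kappa>))"
proof -
  interpret real_distribution M
    using assms(1) by (rule strictly_stable_law_real_distribution)
  have "char (law_at_time \<alpha> M t) \<kappa> = char M (t powr (1 / \<alpha>) * \<kappa>)"
    unfolding law_at_time_def char_def by (subst integral_distr) (auto simp: mult_ac)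
  then show ?thesis
    using assms by (simp add: strictly_stable_law_def stable_exponent_scale)
qed

lemma AE_nonneg_law_at_time:
  assumes "sets M = sets borel" and "AE x in M. 0 \<le> x"
  shows "AE x in law_at_time \<alpha> M t. 0 \<le> x"
proof -
  have [measurable_cong]: "sets M = sets borel" by fact
  show ?thesis
    unfolding law_at_time_def using assms(2)
    by (subst AE_distr_iff) (auto elim!: eventually_mono)
qed

text \<open>The law of T powr (1 / \<alpha>) * Y for independent T and Y with laws \<open>K\<close>
  and \<open>M\<close>. As an image of the product measure it allows Fubini to supply the
  conditioning formulas, both for measures of sets and for characteristic functions.\<close>

definition mixture_law :: "real measure \<Rightarrow> real \<Rightarrow> real measure \<Rightarrow> real measure" where
  "mixture_law K \<alpha> M = distr (K \<Otimes>\<^sub>M M) borel (\<lambda>(\<tau>, y). \<tau> powr (1 / \<alpha>) * y)"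

lemma emeasure_mixture_law:
  assumes "real_distribution K" "real_distribution M" "A \<in> sets borel"
  shows "emeasure (mixture_law K \<alpha> M) A = (\<integral>\<^sup>+\<tau>. emeasure (law_at_time \<alpha> M \<tau>) A \<partial>K)"
proof -
  interpret K: real_distribution K by fact
  interpret M: real_distribution M by fact
  have [measurable]: "A \<in> sets borel" by fact
  let ?g = "\<lambda>(\<tau>, y). \<tau> powr (1 / \<alpha>) * y :: real"
  have "emeasure (mixture_law K \<alpha> M) A = emeasure (K \<Otimes>\<^sub>M M) (?g -` A \<inter> space (K \<Otimes>\<^sub>M M))"
    unfolding mixture_law_def by (intro emeasure_distr) auto
  also have "\<dots> = (\<integral>\<^sup>+\<tau>. emeasure M (Pair \<tau> -` (?g -` A \<inter> space (K \<Otimes>\<^sub>M M))) \<partial>K)"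
    by (intro M.emeasure_pair_measure_alt) measurable
  also have "\<dots> = (\<integral>\<^sup>+\<tau>. emeasure (law_at_time \<alpha> M \<tau>) A \<partial>K)"
    unfolding law_at_time_def
    by (intro nn_integral_cong, subst emeasure_distr)
       (auto simp: space_pair_measure intro!: arg_cong2[where f = emeasure])
  finally show ?thesis .
qed

lemma char_mixture_law:
  assumes "real_distribution K" "real_distribution M"
  shows "char (mixture_law K \<alpha> M) \<kappa> = (CLINT \<tau>|K. char (law_at_time \<alpha> M \<tau>) \<kappa>)"
proof -
  interpret K: real_distribution K by fact
  interpret M: real_distribution M by fact
  interpret P: pair_prob_space K M ..
  let ?f = "\<lambda>(\<tau>, y). iexp (\<kappa> * (\<tau> powr (1 / \<alpha>) * y))"
  have "integrable (K \<Otimes>\<^sub>M M) ?f"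
    by (intro P.integrable_const_bound[where B = 1]) (auto intro!: AE_I2 simp: norm_exp_eq_Re)
  have "char (mixture_law K \<alpha> M) \<kappa> = (CLINT z|K \<Otimes>\<^sub>M M. ?f z)"
    unfolding mixture_law_def char_def by (subst integral_distr) (auto simp: case_prod_unfold)
  also have "\<dots> = (CLINT \<tau>|K. (CLINT y|M. ?f (\<tau>, y)))"
    using P.integral_fst'[OF \<open>integrable (K \<Otimes>\<^sub>M M) ?f\<close>] by simp
  also have "\<dots> = (CLINT \<tau>|K. char (law_at_time \<alpha> M \<tau>) \<kappa>)"
    unfolding law_at_time_def char_def by (subst integral_distr) auto
  finally show ?thesis .
qed

lemma real_distribution_mixture_law:
  assumes "real_distribution K" "real_distribution M"
  shows "real_distribution (mixture_law K \<alpha> M)"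
proof -
  interpret K: real_distribution K by fact
  interpret M: real_distribution M by fact
  interpret P: pair_prob_space K M ..
  have "prob_space (mixture_law K \<alpha> M)"
    unfolding mixture_law_def by (intro P.prob_space_distr) measurable
  then show ?thesis
    by (simp add: real_distribution_def real_distribution_axioms_def mixture_law_def)
qed

section \<open>Subordination as an identity of laws\<close>

lemma subordination_law:
  assumes "feller_parameters \<alpha> \<theta>" "0 < \<beta>" "\<beta> \<le> 1" "0 < t"
    and Mp: "strictly_stable_law (\<beta> * \<alpha>) (\<beta> * \<theta>) Mp"
    and Mq: "strictly_stable_law \<alpha> \<theta> Mq"
    and Mb: "strictly_stable_law \<beta> (- \<beta>) Mb"
  shows "law_at_time (\<beta> * \<alpha>) Mp t = mixture_law (law_at_time \<beta> Mb t) \<alpha> Mq"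
proof (rule Levy_uniqueness)
  let ?K = "law_at_time \<beta> Mb t"
  note rd = strictly_stable_law_real_distribution
  interpret Mb: real_distribution Mb using Mb by (rule rd)
  interpret Mq: real_distribution Mq using Mq by (rule rd)
  have K: "real_distribution ?K"
    using Mb by (intro real_distribution_law_at_time rd)
  interpret K: real_distribution ?K by (rule K)
  show "real_distribution (law_at_time (\<beta> * \<alpha>) Mp t)"
    using Mp by (intro real_distribution_law_at_time rd)
  show "real_distribution (mixture_law ?K \<alpha> Mq)"
    using K Mq rd by (intro real_distribution_mixture_law) auto
  have \<alpha>: "0 < \<alpha>" using assms(1) by (simp add: feller_parameters_def)
  have \<theta>: "\<bar>\<theta>\<bar> \<le> 1" using assms(1) by (rule feller_abs_le_1)
  have AE_Mb: "AE x in Mb. 0 \<le> x"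
    using Mb assms by (intro one_sided_law_AE_nonneg)
  then have AE_K: "AE \<tau> in ?K. 0 \<le> \<tau>"
    by (intro AE_nonneg_law_at_time) simp_all
  show "char (law_at_time (\<beta> * \<alpha>) Mp t) = char (mixture_law ?K \<alpha> Mq)"
  proof
    fix \<kappa>
    let ?\<psi> = "stable_exponent \<alpha> \<theta> \<kappa>"
    let ?s = "of_real (t powr (1 / \<beta>)) * ?\<psi>"
    have Re_s: "0 \<le> Re ?s"
      using Re_stable_exponent_nonneg[OF \<theta>, of \<alpha> \<kappa>] by simp
    have "char (mixture_law ?K \<alpha> Mq) \<kappa> = (CLINT \<tau>|?K. char (law_at_time \<alpha> Mq \<tau>) \<kappa>)"
      using K rd[OF Mq] by (rule char_mixture_law)
    \<comment> \<open>The absolute value is harmless, since \<open>?K\<close> lives on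
      \<open>{0..}\<close>, and gives the integral the form of
      \<open>one_sided_law_laplace\<close>.\<close>
    also have "\<dots> = (CLINT \<tau>|?K. exp (- (of_real \<bar>\<tau>\<bar> * ?\<psi>)))"
    proof (rule integral_cong_AE)
      have "(\<lambda>\<tau>. CLINT y|Mq. iexp (\<kappa> * (\<tau> powr (1 / \<alpha>) * y))) \<in> borel_measurable ?K"
        by measurable
      then show "(\<lambda>\<tau>. char (law_at_time \<alpha> Mq \<tau>) \<kappa>) \<in> borel_measurable ?K"
        unfolding law_at_time_def char_def by (subst integral_distr) auto
      show "AE \<tau> in ?K. char (law_at_time \<alpha> Mq \<tau>) \<kappa> = exp (- (of_real \<bar>\<tau>\<bar> * ?\<psi>))"
        using AE_K by eventually_elim (simp add: char_law_at_time[OF Mq _ \<alpha>])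
    qed measurable
    also have "\<dots> = (CLINT u|Mb. exp (- (?s * of_real \<bar>u\<bar>)))"
      unfolding law_at_time_def by (subst integral_distr) (auto simp: abs_mult mult_ac)
    also have "\<dots> = exp (- (?s powr of_real \<beta>))"
      using Mb assms Re_s by (intro one_sided_law_laplace) auto
    \<comment> \<open>A positive real factor does not change the angle, so the power splits without
      a branch correction, and t powr (1 / \<beta>) becomes t.\<close>
    also have "?s powr of_real \<beta> = of_real t * (?\<psi> powr of_real \<beta>)"
      using assms by (subst powr_times_real_left) (auto simp: powr_of_real powr_powr simp del: of_real_mult)
    also have "\<dots> = of_real t * stable_exponent (\<beta> * \<alpha>) (\<beta> * \<theta>) \<kappa>"
      by (simp add: stable_exponent_powr[OF \<theta>])
    also have "exp (- \<dots>) = char (law_at_time (\<beta> * \<alpha>) Mp t) \<kappa>"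
      using Mp assms \<alpha> by (subst char_law_at_time) auto
    finally show "char (law_at_time (\<beta> * \<alpha>) Mp t) \<kappa> = char (mixture_law ?K \<alpha> Mq) \<kappa>" ..
  qed
qed

text \<open>Stated for laws, this applies to point masses and to densities alike: it settles the
  degenerate case and feeds the almost everywhere identity of the densities.\<close>

lemma subordination_emeasure:
  assumes "feller_parameters \<alpha> \<theta>" "0 < \<beta>" "\<beta> \<le> 1" "0 < t"
    and Mp: "strictly_stable_law (\<beta> * \<alpha>) (\<beta> * \<theta>) Mp"
    and Mq: "strictly_stable_law \<alpha> \<theta> Mq"
    and Mb: "strictly_stable_law \<beta> (- \<beta>) Mb"
    and A: "A \<in> sets borel" "A \<subseteq> {0<..}"
  shows "emeasure (law_at_time (\<beta> * \<alpha>) Mp t) A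
    = (\<integral>\<^sup>+\<tau>\<in>{0<..}. emeasure (law_at_time \<alpha> Mq \<tau>) A \<partial>law_at_time \<beta> Mb t)"
proof -
  let ?K = "law_at_time \<beta> Mb t"
  note rd = strictly_stable_law_real_distribution
  interpret Mb: real_distribution Mb using Mb by (rule rd)
  interpret Mq: real_distribution Mq using Mq by (rule rd)
  have K: "real_distribution ?K"
    using Mb by (intro real_distribution_law_at_time rd)
  have "AE \<tau> in ?K. 0 \<le> \<tau>"
    using Mb assms by (intro AE_nonneg_law_at_time one_sided_law_AE_nonneg) simp_all
  have at_0: "emeasure (law_at_time \<alpha> Mq 0) A = 0"
    unfolding law_at_time_def using A by (subst emeasure_distr) (auto simp: vimage_def)
  have "emeasure (law_at_time (\<beta> * \<alpha>) Mp t) A = (\<integral>\<^sup>+\<tau>. emeasure (law_at_time \<alpha> Mq \<tau>) A \<partial>?K)"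
    using subordination_law[OF assms(1-7)] emeasure_mixture_law[OF K rd[OF Mq] A(1)] by simp
  also have "\<dots> = (\<integral>\<^sup>+\<tau>\<in>{0<..}. emeasure (law_at_time \<alpha> Mq \<tau>) A \<partial>?K)"
    using \<open>AE \<tau> in ?K. 0 \<le> \<tau>\<close>
  proof (intro nn_integral_cong_AE, eventually_elim)
    case (elim \<tau>)
    then show ?case using at_0 by (cases "\<tau> = 0") (auto simp: indicator_def)
  qed
  finally show ?thesis .
qed

section \<open>Bounds for truncated Fourier integrals\<close>

text \<open>The integrand is an exact derivative, unbounded at 0 when \<alpha> < 1; hence the
  fundamental theorem in the form that differentiates only in the interior. The value is at most 1 /
  c, uniformly in T and \<alpha>.\<close>

lemma powr_alpha_exp_has_integral:
  fixes c \<alpha> T :: real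
  assumes "0 < c" "0 < \<alpha>" "0 \<le> T"
  shows "((\<lambda>t. \<alpha> * t powr (\<alpha> - 1) * exp (- (t powr \<alpha> * c))) has_integral
    (1 - exp (- (T powr \<alpha> * c))) / c) {0..T}"
proof -
  have "((\<lambda>t. \<alpha> * t powr (\<alpha> - 1) * exp (- (t powr \<alpha> * c))) has_integral
      (- (exp (- (T powr \<alpha> * c)) / c) - - (exp (- (0 powr \<alpha> * c)) / c))) {0..T}"
  proof (rule fundamental_theorem_of_calculus_interior)
    show "continuous_on {0..T} (\<lambda>t. - (exp (- (t powr \<alpha> * c)) / c))"
      using assms by (intro continuous_intros continuous_on_powr') auto
    show "((\<lambda>t. - (exp (- (t powr \<alpha> * c)) / c)) has_vector_derivative
        \<alpha> * t powr (\<alpha> - 1) * exp (- (t powr \<alpha> * c))) (at t)" if "t \<in> {0<..<T}" for t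
      using assms that
      by (auto intro!: derivative_eq_intros
          simp: has_real_derivative_iff_has_vector_derivative[symmetric])
  qed (use assms in auto)
  then show ?thesis using assms by (simp add: diff_divide_distrib)
qed

text \<open>Integration by parts. The derivative of \<open>G\<close> is
  \<open>- (\<i> * of_real x) * G t + H t\<close>, so x times the integral of \<open>G\<close> is
  controlled by the boundary values, which contribute the 2, and by the integral of
  \<open>H\<close>, which contributes 1 / Re w. Nothing depends on T.\<close>

lemma oscillatory_powr_integral_bound:
  fixes w :: complex and x T \<alpha> :: real
  assumes "0 < \<alpha>" "norm w = 1" "0 < Re w" "x \<noteq> 0" "0 \<le> T"
  shows "norm (integral {0..T} (\<lambda>t. iexp (- (t * x)) * exp (- (of_real (t powr \<alpha>) * w))))
    \<le> (2 + 1 / Re w) / \<bar>x\<bar>"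
proof -
  define G where "G t = iexp (- (t * x)) * exp (- (of_real (t powr \<alpha>) * w))" for t
  define H where "H t = - (of_real (\<alpha> * t powr (\<alpha> - 1)) * w) * G t" for t
  have G_eq: "G = (\<lambda>t. exp (\<i> * of_real (- (t * x)) - of_real (t powr \<alpha>) * w))"
    by (simp add: G_def fun_eq_iff exp_diff exp_minus divide_inverse)
  have norm_G: "norm (G t) = exp (- (t powr \<alpha> * Re w))" for t
    by (simp add: G_def norm_mult norm_exp_eq_Re)
  have G_le: "norm (G t) \<le> 1" for t
    using assms by (simp add: norm_G)
  have cont: "continuous_on {0..T} G"
    unfolding G_def using assms by (intro continuous_intros continuous_on_powr') auto
  have GH: "((\<lambda>t. - (\<i> * of_real x) * G t + H t) has_integral G T - G 0) {0..T}"
  proof (rule fundamental_theorem_of_calculus_interior)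
    fix t assume "t \<in> {0<..<T}"
    then have t: "0 < t" by simp
    have "((\<lambda>t. t powr \<alpha>) has_field_derivative \<alpha> * t powr (\<alpha> - 1)) (at t)"
      using t by (auto intro!: derivative_eq_intros)
    then have "((\<lambda>t. complex_of_real (t powr \<alpha>)) has_vector_derivative
        complex_of_real (\<alpha> * t powr (\<alpha> - 1))) (at t)"
      by (rule has_vector_derivative_of_real)
    note powr = has_vector_derivative_mult_left[OF this, of w]
    have "((\<lambda>t. - (t * x)) has_field_derivative - x) (at t)"
      by (auto intro!: derivative_eq_intros)
    then have "((\<lambda>t. complex_of_real (- (t * x))) has_vector_derivative of_real (- x)) (at t)"
      by (rule has_vector_derivative_of_real)
    note lin = has_vector_derivative_mult_right[OF this, of \<i>]
    have 1: "((\<lambda>t. \<i> * of_real (- (t * x)) - of_real (t powr \<alpha>) * w) has_vector_derivative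
        - (\<i> * of_real x) - of_real (\<alpha> * t powr (\<alpha> - 1)) * w) (at t)"
      using has_vector_derivative_diff[OF lin powr] by simp
    have "(exp has_field_derivative exp (\<i> * of_real (- (t * x)) - of_real (t powr \<alpha>) * w))
        (at (\<i> * of_real (- (t * x)) - of_real (t powr \<alpha>) * w))"
      by (rule DERIV_exp)
    from field_vector_diff_chain_at[OF 1 this]
    have deriv: "(G has_vector_derivative
        (- (\<i> * of_real x) - of_real (\<alpha> * t powr (\<alpha> - 1)) * w) * G t) (at t)"
      by (simp only: G_eq o_def)
    have eq: "- (\<i> * of_real x) * G t + H t
        = (- (\<i> * of_real x) - of_real (\<alpha> * t powr (\<alpha> - 1)) * w) * G t"
      unfolding H_def by (simp only: diff_conv_add_uminus distrib_right)
    show "(G has_vector_derivative - (\<i> * of_real x) * G t + H t) (at t)"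
      unfolding eq by (rule deriv)
  qed (use assms cont in auto)
  have "G integrable_on {0..T}"
    using cont by (rule integrable_continuous_real)
  then have G: "((\<lambda>t. - (\<i> * of_real x) * G t) has_integral - (\<i> * of_real x) * integral {0..T} G) {0..T}"
    by (intro has_integral_mult_right integrable_integral)
  \<comment> \<open>\<open>H\<close> may be singular at 0; its integrability is inherited from the
    derivative of \<open>G\<close> and from the continuous function \<open>G\<close>.\<close>
  have H: "(H has_integral G T - G 0 - (- (\<i> * of_real x) * integral {0..T} G)) {0..T}"
    using has_integral_diff[OF GH G] by simp
  have "norm (integral {0..T} H) \<le> integral {0..T} (\<lambda>t. \<alpha> * t powr (\<alpha> - 1) * exp (- (t powr \<alpha> * Re w)))"
  proof (rule integral_norm_bound_integral)
    show "H integrable_on {0..T}" using H by blast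
    show "(\<lambda>t. \<alpha> * t powr (\<alpha> - 1) * exp (- (t powr \<alpha> * Re w))) integrable_on {0..T}"
      using powr_alpha_exp_has_integral[of "Re w" \<alpha> T] assms by blast
  qed (use assms in \<open>simp add: H_def norm_mult norm_G\<close>)
  also have "\<dots> = (1 - exp (- (T powr \<alpha> * Re w))) / Re w"
    using powr_alpha_exp_has_integral[of "Re w" \<alpha> T] assms by (intro integral_unique) auto
  also have "\<dots> \<le> 1 / Re w"
    using assms by (intro divide_right_mono) auto
  finally have "norm (integral {0..T} H) \<le> 1 / Re w" .
  moreover have "\<i> * of_real x * integral {0..T} G = integral {0..T} H - (G T - G 0)"
    using integral_unique[OF H] by simp
  then have "norm (\<i> * of_real x * integral {0..T} G) \<le> norm (integral {0..T} H) + (norm (G T) + norm (G 0))"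
    using norm_triangle_ineq4[of "integral {0..T} H" "G T - G 0"] norm_triangle_ineq4[of "G T" "G 0"]
    by simp
  ultimately have "\<bar>x\<bar> * norm (integral {0..T} G) \<le> 2 + 1 / Re w"
    using G_le[of T] G_le[of 0] by (simp add: norm_mult)
  then show ?thesis
    using assms(4) unfolding G_def by (simp add: field_simps)
qed

lemma stable_fourier_integral_bound:
  assumes "0 < \<alpha>" "\<bar>\<theta>\<bar> < 1" "x \<noteq> 0" "0 \<le> T"
  shows "norm (integral {-T..T} (\<lambda>t. iexp (- (t * x)) * exp (- stable_exponent \<alpha> \<theta> t)))
    \<le> 2 * (2 + 1 / cos (\<theta> * pi / 2)) / \<bar>x\<bar>"
proof -
  let ?f = "\<lambda>t. iexp (- (t * x)) * exp (- stable_exponent \<alpha> \<theta> t)"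
  let ?F = "\<lambda>w x. integral {0..T} (\<lambda>t. iexp (- (t * x)) * exp (- (of_real (t powr \<alpha>) * w)))"
  define w where "w = exp (\<i> * of_real (\<theta> * pi / 2))"
  have "\<bar>\<theta>\<bar> * (pi / 2) < 1 * (pi / 2)"
    using assms by (intro mult_strict_right_mono) auto
  then have "\<bar>\<theta> * pi / 2\<bar> < pi / 2" by (simp add: abs_mult)
  then have c: "0 < cos (\<theta> * pi / 2)"
    unfolding abs_less_iff by (intro cos_gt_zero_pi) linarith+
  have w: "norm w = 1" "Re w = cos (\<theta> * pi / 2)"
    by (simp_all add: w_def norm_exp_eq_Re Re_exp)
  \<comment> \<open>Since sgn 0 = 0, the phase jumps at t = 0, but the factor
    \<open>t powr \<alpha>\<close> vanishes there. The negative half-line below reflects to the same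
    integral with \<open>cnj w\<close> and - x, which doubles the constant.\<close>
  have pos: "integral {0..T} ?f = ?F w x"
  proof (rule integral_cong)
    fix t assume "t \<in> {0..T}"
    then show "?f t = iexp (- (t * x)) * exp (- (of_real (t powr \<alpha>) * w))"
      by (cases "t = 0") (auto simp: stable_exponent_def w_def)
  qed
  have "integral {-T..0} ?f = integral {0..T} (\<lambda>t. ?f (- t))"
    using Henstock_Kurzweil_Integration.integral_reflect_real[of T 0 "\<lambda>t. ?f (- t)"] by simp
  also have "\<dots> = ?F (cnj w) (- x)"
  proof (rule integral_cong)
    fix t assume "t \<in> {0..T}"
    then show "?f (- t) = iexp (- (t * - x)) * exp (- (of_real (t powr \<alpha>) * cnj w))"
      by (cases "t = 0") (auto simp: stable_exponent_def w_def exp_cnj)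
  qed
  finally have neg: "integral {-T..0} ?f = ?F (cnj w) (- x)" .
  show ?thesis
  proof (cases "?f integrable_on {-T..T}")
    case True
    then have "integral {-T..T} ?f = integral {-T..0} ?f + integral {0..T} ?f"
      using assms by (intro Henstock_Kurzweil_Integration.integral_combine[symmetric]) auto
    then have "norm (integral {-T..T} ?f) \<le> norm (?F (cnj w) (- x)) + norm (?F w x)"
      unfolding pos neg by (simp add: norm_triangle_ineq)
    also have "\<dots> \<le> (2 + 1 / Re (cnj w)) / \<bar>- x\<bar> + (2 + 1 / Re w) / \<bar>x\<bar>"
      using assms c w by (intro add_mono oscillatory_powr_integral_bound) auto
    finally show ?thesis by (simp add: w add_divide_distrib mult_ac)
  next
    \<comment> \<open>The integral of a non-integrable function is 0 by default, and 0 satisfies the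
      bound.\<close>
    case False
    then show ?thesis using c by (simp add: not_integrable_integral)
  qed
qed

section \<open>From Fourier integrals to a pointwise bound on the density\<close>

lemma integral_iexp:
  assumes "a \<le> b" "t \<noteq> 0"
  shows "integral {a..b} (\<lambda>x. iexp (- (t * x))) = (iexp (- (t * a)) - iexp (- (t * b))) / (\<i> * of_real t)"
proof -
  have "((\<lambda>x. iexp (- (t * x))) has_integral
      (iexp (- (t * b)) / (- (\<i> * of_real t)) - iexp (- (t * a)) / (- (\<i> * of_real t)))) {a..b}"
  proof (rule fundamental_theorem_of_calculus)
    fix x
    have 1: "((\<lambda>x. - (t * x)) has_vector_derivative - t) (at x within {a..b})"
      by (auto intro!: derivative_eq_intros)
    have "((\<lambda>x. iexp (- (t * x))) has_vector_derivative (- t) *\<^sub>R (\<i> * iexp (- (t * x)))) (at x within {a..b})"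
      using vector_diff_chain_within[OF 1 has_vector_derivative_iexp] by (simp add: o_def)
    then have "((\<lambda>x. iexp (- (t * x)) / (- (\<i> * of_real t))) has_vector_derivative
        (- t) *\<^sub>R (\<i> * iexp (- (t * x))) / (- (\<i> * of_real t))) (at x within {a..b})"
      by (rule has_vector_derivative_divide)
    then show "((\<lambda>x. iexp (- (t * x)) / (- (\<i> * of_real t))) has_vector_derivative iexp (- (t * x)))
        (at x within {a..b})"
      using assms by (simp add: scaleR_conv_of_real)
  qed fact
  then show ?thesis
    by (subst integral_unique) (auto simp: diff_divide_distrib)
qed

text \<open>The kernel in Levy's inversion formula is itself the integral of
  \<open>iexp (- (t * x))\<close> over x in \<open>{a..b}\<close>. While T is finite, exchanging the
  two integrals concerns a continuous function on a compact rectangle.\<close>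

lemma (in real_distribution) Levy_integral_eq:
  assumes "a \<le> b" "0 \<le> T"
  shows "(CLBINT t=-T..T. (iexp (-(t * a)) - iexp (-(t * b))) / (\<i> * t) * char M t)
    = integral {a..b} (\<lambda>x. integral {-T..T} (\<lambda>t. iexp (- (t * x)) * char M t))"
proof -
  let ?F = "\<lambda>t. integral {a..b} (\<lambda>x. iexp (- (t * x)) * char M t)"
  have cont_char: "continuous_on A (\<lambda>z. char M (f z))" if "continuous_on A f" for A and f :: "'b::t2_space \<Rightarrow> real"
    using continuous_on_compose2[of UNIV "char M" A f] that
    by (auto intro: continuous_at_imp_continuous_on isCont_char)
  have cont: "continuous_on S (\<lambda>(t, x). iexp (- (t * x)) * char M t)" for S
    unfolding case_prod_unfold by (intro continuous_intros cont_char)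
  have F_cont: "continuous_on {-T..T} ?F"
    using integral_continuous_on_param[of "{-T..T}" a b "\<lambda>t x. iexp (- (t * x)) * char M t"] cont
    by simp
  have F_eq: "?F t = (iexp (-(t * a)) - iexp (-(t * b))) / (\<i> * t) * char M t" if "t \<noteq> 0" for t
    using integral_iexp[OF assms(1) that] by simp
  have "(CLBINT t=-T..T. (iexp (-(t * a)) - iexp (-(t * b))) / (\<i> * t) * char M t)
      = (CLBINT t:{-T..T}. (iexp (-(t * a)) - iexp (-(t * b))) / (\<i> * t) * char M t)"
    using assms by (subst interval_integral_Icc) auto
  also have "\<dots> = (CLBINT t:{-T..T}. ?F t)"
    unfolding set_lebesgue_integral_def
  proof (rule integral_cong_AE)
    have "set_borel_measurable borel {-T..T} ?F"
      using F_cont by (intro set_measurable_continuous_on) auto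
    then show "(\<lambda>t. indicator {-T..T} t *\<^sub>R ?F t) \<in> borel_measurable lborel"
      by (simp add: set_borel_measurable_def)
    \<comment> \<open>At t = 0 division by zero makes the left side 0, whereas \<open>?F 0\<close>
      is b - a.\<close>
    show "AE t in lborel. indicator {-T..T} t *\<^sub>R ((iexp (-(t * a)) - iexp (-(t * b))) / (\<i> * t) * char M t)
        = indicator {-T..T} t *\<^sub>R ?F t"
      using AE_lborel_singleton[of 0]
    proof eventually_elim
      case (elim t)
      then show ?case by (simp only: F_eq[OF elim])
    qed
  qed measurable
  also have "\<dots> = integral {-T..T} ?F"
    using F_cont by (intro set_borel_integral_eq_integral borel_integrable_atLeastAtMost')
  also have "\<dots> = integral {a..b} (\<lambda>x. integral {-T..T} (\<lambda>t. iexp (- (t * x)) * char M t))"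
    using integral_swap_continuous[of "-T" a T b "\<lambda>t x. iexp (- (t * x)) * char M t"] cont by simp
  finally show ?thesis by simp
qed

text \<open>The bound on the truncated integrals is uniform in T and thus survives the limit in
  Levy's inversion formula. On \<open>{a..b}\<close> it is largest at a, whence the division by a;
  the factor 1 / (2 * pi) of the formula cancels the 2 in \<open>C\<close>.\<close>

lemma stable_law_interval_bound:
  assumes M: "strictly_stable_law \<alpha> \<theta> M" and atoms: "\<And>x. measure M {x} = 0"
    and "0 < \<alpha>" "\<bar>\<theta>\<bar> < 1" "0 < a" "a \<le> b"
  shows "measure M {a<..b} \<le> (2 + 1 / cos (\<theta> * pi / 2)) / pi * (b - a) / a"
proof -
  interpret real_distribution M
    using M by (simp add: strictly_stable_law_def)
  define C where "C = 2 * (2 + 1 / cos (\<theta> * pi / 2))"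
  have bd: "norm (integral {-T..T} (\<lambda>t. iexp (- (t * x)) * char M t)) \<le> C / x"
    if "0 \<le> T" "0 < x" for T x
    using stable_fourier_integral_bound[of \<alpha> \<theta> x T] that assms
    by (simp add: strictly_stable_law_def C_def)
  have C: "0 \<le> C"
    using order_trans[OF norm_ge_zero bd[of 0 1]] by simp
  let ?I = "\<lambda>T. CLBINT t=-T..T. (iexp (-(t * a)) - iexp (-(t * b))) / (\<i> * t) * char M t"
  have I: "norm (?I (real n)) \<le> C / a * (b - a)" for n :: nat
  proof -
    let ?K = "\<lambda>x. integral {-real n..real n} (\<lambda>t. iexp (- (t * x)) * char M t)"
    have "norm (integral {a..b} ?K) \<le> C / a * (b - a)"
    proof (cases "?K integrable_on {a..b}")
      case True
      have "norm (?K x) \<le> C / a" if "x \<in> {a..b}" for x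
      proof -
        have "norm (?K x) \<le> C / x" using that assms by (intro bd) auto
        also have "\<dots> \<le> C / a" using that assms C by (intro divide_left_mono) auto
        finally show ?thesis .
      qed
      then show ?thesis
        using has_integral_bound[OF _ integrable_integral[OF True[unfolded box_real(2)[symmetric]]], of "C / a"]
          assms C by simp
    qed (use assms C in \<open>simp add: not_integrable_integral\<close>)
    then show ?thesis
      using Levy_integral_eq[OF \<open>a \<le> b\<close>, of "real n"] by simp
  qed
  have pi: "norm (complex_of_real (1 / (2 * pi))) = 1 / (2 * pi)"
    by (simp only: norm_of_real) simp
  have "norm (1 / (2 * pi) * ?I (real n)) \<le> 1 / (2 * pi) * (C / a * (b - a))" for n :: nat
    unfolding norm_mult pi by (intro mult_left_mono I) simp
  moreover have "(\<lambda>n. 1 / (2 * pi) * ?I (real n)) \<longlonglongrightarrow> of_real (measure M {a<..b})"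
    using Levy_Inversion[of a b] assms by simp
  ultimately have "norm (complex_of_real (measure M {a<..b})) \<le> 1 / (2 * pi) * (C / a * (b - a))"
    by (intro LIMSEQ_le_const2[OF tendsto_norm]) auto
  moreover have "1 / (2 * pi) * ((2 * K) / a * (b - a)) = K / pi * (b - a) / a" for K :: real
    by simp
  ultimately show ?thesis
    unfolding C_def by (simp only: norm_of_real abs_of_nonneg[OF measure_nonneg])
qed

lemma strictly_stable_density_measurable:
  "strictly_stable_density \<alpha> \<theta> L \<Longrightarrow> L \<in> borel_measurable borel"
  by (auto simp: strictly_stable_density_def intro: borel_measurable_continuous_onI)

text \<open>If the bound failed at x, then by continuity L would exceed some m above the bound on a
  short interval to the right of x, giving that interval more mass than
  \<open>stable_law_interval_bound\<close> allows.\<close>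

lemma stable_density_le_inverse:
  assumes L: "strictly_stable_density \<alpha> \<theta> L" and "0 < \<alpha>" "\<bar>\<theta>\<bar> < 1" "0 < x"
  shows "L x \<le> (2 + 1 / cos (\<theta> * pi / 2)) / pi / x"
proof (rule ccontr)
  let ?C = "(2 + 1 / cos (\<theta> * pi / 2)) / pi / x"
  let ?M = "density lborel L"
  assume "\<not> L x \<le> ?C"
  then have "?C < L x" by (simp only: not_le)
  then obtain m where m: "?C < m" "m < L x"
    using dense by blast
  have [measurable]: "L \<in> borel_measurable borel"
    using L by (rule strictly_stable_density_measurable)
  have M: "strictly_stable_law \<alpha> \<theta> ?M" and nonneg: "\<And>x. 0 \<le> L x"
    using L by (auto simp: strictly_stable_density_def)
  interpret real_distribution ?M
    using M by (rule strictly_stable_law_real_distribution)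
  have "isCont L x"
    using L by (simp add: strictly_stable_density_def continuous_on_eq_continuous_at)
  then have "\<forall>\<^sub>F y in at x. m < L y"
    using m by (intro order_tendstoD) (simp add: isCont_def)
  then obtain d where d: "0 < d" "\<And>y. y \<noteq> x \<Longrightarrow> dist y x < d \<Longrightarrow> m < L y"
    by (auto simp: eventually_at)
  define b where "b = x + d / 2"
  have atoms: "measure ?M {y} = 0" for y
  proof -
    have "AE z in lborel. ennreal (L z) * indicator {y} z = 0"
      using AE_lborel_singleton[of y] by eventually_elim simp
    then show ?thesis
      by (simp add: measure_def emeasure_density nn_integral_0_iff_AE)
  qed
  have "measure ?M {x<..b} \<le> (2 + 1 / cos (\<theta> * pi / 2)) / pi * (b - x) / x"
    using M atoms assms d by (intro stable_law_interval_bound) (auto simp: b_def)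
  then have upper: "measure ?M {x<..b} \<le> ?C * (b - x)" by simp
  have m_le: "m \<le> L y" if "y \<in> {x<..b}" for y
    using d that by (intro less_imp_le d(2)) (auto simp: b_def dist_real_def)
  have bx: "0 \<le> b - x" using d by (simp add: b_def)
  have "ennreal (m * (b - x)) = (\<integral>\<^sup>+y. ennreal m * indicator {x<..b} y \<partial>lborel)"
    using bx by (simp add: nn_integral_cmult_indicator ennreal_mult'')
  also have "\<dots> \<le> (\<integral>\<^sup>+y. ennreal (L y) * indicator {x<..b} y \<partial>lborel)"
    using m_le by (intro nn_integral_mono) (auto simp: indicator_def intro!: ennreal_leI)
  also have "\<dots> = emeasure ?M {x<..b}"
    by (subst emeasure_density) auto
  also have "\<dots> = ennreal (measure ?M {x<..b})"
    by (rule emeasure_eq_measure)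
  finally have "m * (b - x) \<le> measure ?M {x<..b}"
    by simp
  also note upper
  finally have "m * (b - x) \<le> ?C * (b - x)" .
  moreover have "0 < b - x" using d by (simp add: b_def)
  ultimately have "m \<le> ?C" by (rule mult_right_le_imp_le)
  then show False using m(1) by (rule leD[THEN notE])
qed

text \<open>The prefactor t powr (- 1 / \<alpha>) cancels against the rescaling of x, so the
  constant is the same for all times.\<close>

lemma density_at_time_le_inverse:
  assumes "strictly_stable_density \<alpha> \<theta> L" "0 < \<alpha>" "\<bar>\<theta>\<bar> < 1" "0 < x" "0 < t"
  shows "density_at_time \<alpha> L t x \<le> (2 + 1 / cos (\<theta> * pi / 2)) / pi / x"
proof -
  have "t powr (- 1 / \<alpha>) * L (x / t powr (1 / \<alpha>))
      \<le> t powr (- 1 / \<alpha>) * ((2 + 1 / cos (\<theta> * pi / 2)) / pi / (x / t powr (1 / \<alpha>)))"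
    using assms by (intro mult_left_mono stable_density_le_inverse) auto
  also have "\<dots> = (2 + 1 / cos (\<theta> * pi / 2)) / pi / x"
    using assms by (simp add: powr_minus_divide)
  finally show ?thesis by (simp add: density_at_time_def)
qed

section \<open>Subordination at every point\<close>

lemma density_at_time_nonneg:
  "strictly_stable_density \<alpha> \<theta> L \<Longrightarrow> 0 \<le> density_at_time \<alpha> L t x"
  by (simp add: density_at_time_def strictly_stable_density_def)

lemma density_at_time_measurable [measurable (raw)]:
  assumes [measurable]: "L \<in> borel_measurable borel" "f \<in> borel_measurable M" "g \<in> borel_measurable M"
  shows "(\<lambda>z. density_at_time \<alpha> L (f z) (g z)) \<in> borel_measurable M"
  unfolding density_at_time_def by measurable

lemma continuous_on_density_at_time:
  assumes "strictly_stable_density \<alpha> \<theta> L" "0 < t"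
  shows "continuous_on UNIV (density_at_time \<alpha> L t)"
proof -
  have "continuous_on UNIV L"
    using assms(1) by (simp add: strictly_stable_density_def)
  moreover have "continuous_on UNIV (\<lambda>x. x / t powr (1 / \<alpha>))"
    using assms(2) by (intro continuous_intros) auto
  ultimately have "continuous_on UNIV (\<lambda>x. L (x / t powr (1 / \<alpha>)))"
    by (rule continuous_on_compose2) simp
  then show ?thesis
    unfolding density_at_time_def[abs_def] by (intro continuous_intros)
qed

text \<open>The set of disagreement is open, because the target space is Hausdorff, and null; a
  nonempty open set is never null.\<close>

lemma AE_eq_continuous_on_imp_eq:
  fixes f g :: "'a::euclidean_space \<Rightarrow> 'b::{t2_space}"
  assumes "open S" "continuous_on S f" "continuous_on S g"
    and "AE x in lborel. x \<in> S \<longrightarrow> f x = g x" and "x \<in> S"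
  shows "f x = g x"
proof (rule ccontr)
  assume "f x \<noteq> g x"
  let ?U = "{x \<in> S. f x \<noteq> g x}"
  have "?U = S \<inter> (\<lambda>x. (f x, g x)) -` (- {p. fst p = snd p})" by auto
  moreover have "closed {p :: 'b \<times> 'b. fst p = snd p}"
    by (intro closed_Collect_eq continuous_intros)
  ultimately have "open ?U"
    using assms(1-3) by (auto intro!: continuous_open_preimage continuous_on_Pair open_Compl)
  have "AE x in lebesgue. x \<in> - ?U"
    using assms(4) by (intro AE_completion) auto
  then have "x \<in> - ?U"
    using mem_closed_if_AE_lebesgue[of "- ?U" x] \<open>open ?U\<close> by auto
  then show False using \<open>f x \<noteq> g x\<close> \<open>x \<in> S\<close> by simp
qed

lemma subordination_density:
  assumes "feller_parameters \<alpha> \<theta>" "\<bar>\<theta>\<bar> < 1" "0 < \<beta>" "\<beta> \<le> 1"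
    and Lp: "strictly_stable_density (\<beta> * \<alpha>) (\<beta> * \<theta>) Lp"
    and Lq: "strictly_stable_density \<alpha> \<theta> Lq"
    and Lb: "strictly_stable_density \<beta> (- \<beta>) Lb"
    and "0 < t" "0 < x"
  shows "set_integrable lborel {0<..} (\<lambda>\<tau>. density_at_time \<alpha> Lq \<tau> x * density_at_time \<beta> Lb t \<tau>)"
    and "density_at_time (\<beta> * \<alpha>) Lp t x
      = (LBINT \<tau>:{0<..}. density_at_time \<alpha> Lq \<tau> x * density_at_time \<beta> Lb t \<tau>)"
proof -
  let ?p = "density_at_time (\<beta> * \<alpha>) Lp t"
  let ?q = "density_at_time \<alpha> Lq"
  let ?b = "density_at_time \<beta> Lb t"
  \<comment> \<open>The cut-off is built into \<open>h\<close> because \<open>?q \<tau> x\<close> is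
    bounded only for \<tau> > 0, while Fubini is applied on the whole line.\<close>
  define h where "h x \<tau> = indicator {0<..} \<tau> * (?q \<tau> x * ?b \<tau>)" for x \<tau>
  define C where "C = (2 + 1 / cos (\<theta> * pi / 2)) / pi"
  have \<alpha>: "0 < \<alpha>" using assms by (simp add: feller_parameters_def)
  have [measurable]: "Lp \<in> borel_measurable borel" "Lq \<in> borel_measurable borel" "Lb \<in> borel_measurable borel"
    using Lp Lq Lb by (auto intro: strictly_stable_density_measurable)
  note nonneg = density_at_time_nonneg[OF Lp] density_at_time_nonneg[OF Lq] density_at_time_nonneg[OF Lb]
  have laws: "strictly_stable_law (\<beta> * \<alpha>) (\<beta> * \<theta>) (density lborel Lp)"
    "strictly_stable_law \<alpha> \<theta> (density lborel Lq)" "strictly_stable_law \<beta> (- \<beta>) (density lborel Lb)"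
    using Lp Lq Lb by (auto simp: strictly_stable_density_def)
  have [measurable]: "?p \<in> borel_measurable borel" "?b \<in> borel_measurable borel"
    using Lp Lb assms
    by (auto intro!: borel_measurable_continuous_onI continuous_on_density_at_time)
  have h_meas [measurable (raw)]: "(\<lambda>z. h (f z) (g z)) \<in> borel_measurable M"
    if [measurable]: "f \<in> borel_measurable M" "g \<in> borel_measurable M" for f g and M :: "'m measure"
    unfolding h_def by measurable
  have h_nonneg: "0 \<le> h x \<tau>" for x \<tau>
    using nonneg by (simp add: h_def)
  have C: "0 \<le> C"
    using density_at_time_le_inverse[OF Lq \<alpha> assms(2), of 1 1] nonneg(2)[of 1 1] by (simp add: C_def)
  have h_le: "h x \<tau> \<le> C / x * ?b \<tau>" if "0 < x" for x \<tau>
  proof (cases "0 < \<tau>")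
    case True
    have "?q \<tau> x \<le> C / x"
      unfolding C_def using Lq \<alpha> assms(2) that True by (rule density_at_time_le_inverse)
    then have "?q \<tau> x * ?b \<tau> \<le> C / x * ?b \<tau>"
      using nonneg(3) by (rule mult_right_mono)
    then show ?thesis using True by (simp add: h_def)
  next
    case False
    have "0 \<le> C / x * ?b \<tau>"
      using C that nonneg(3) by (intro mult_nonneg_nonneg divide_nonneg_pos)
    then show ?thesis using False by (simp add: h_def)
  qed
  have prob_b: "real_distribution (density lborel ?b)"
    using laws(3) real_distribution_law_at_time[of "density lborel Lb" \<beta> t] \<open>0 < t\<close>
    by (simp add: law_at_time_density strictly_stable_law_def)
  have b_int: "integrable lborel ?b"
  proof (rule integrableI_nonneg)
    have "(\<integral>\<^sup>+\<tau>. ennreal (?b \<tau>) \<partial>lborel) = emeasure (density lborel ?b) UNIV"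
      by (subst emeasure_density) auto
    also have "\<dots> = 1"
      using prob_b prob_space.emeasure_space_1[of "density lborel ?b"]
      by (simp add: real_distribution_def)
    finally show "(\<integral>\<^sup>+\<tau>. ennreal (?b \<tau>) \<partial>lborel) < \<infinity>" by simp
  qed (use nonneg in auto)
  have h_int: "integrable lborel (h x)" if "0 < x" for x
  proof (rule Bochner_Integration.integrable_bound)
    show "integrable lborel (\<lambda>\<tau>. C / x * ?b \<tau>)"
      by (intro integrable_mult_right b_int)
    show "AE \<tau> in lborel. norm (h x \<tau>) \<le> norm (C / x * ?b \<tau>)"
    proof (intro AE_I2)
      fix \<tau>
      have "norm (h x \<tau>) = h x \<tau>"
        using h_nonneg by simp
      also have "\<dots> \<le> norm (C / x * ?b \<tau>)"
        using h_le[OF that, of \<tau>] unfolding real_norm_def by (rule order_trans[OF _ abs_ge_self])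
      finally show "norm (h x \<tau>) \<le> norm (C / x * ?b \<tau>)" .
    qed
  qed measurable
  let ?R = "\<lambda>x. \<integral>\<tau>. h x \<tau> \<partial>lborel"
  have R_cont: "continuous_on {0<..} ?R"
    unfolding continuous_on_sequentially
  proof safe
    fix X :: "nat \<Rightarrow> real" and x assume X: "\<forall>n. X n \<in> {0<..}" "X \<longlonglongrightarrow> x" and x: "0 < x"
    \<comment> \<open>The dominating function must not depend on n: once X n exceeds x / 2, the
      multiple C / (x / 2) of \<open>?b\<close> serves for all later terms. This is the reason for
      the shift by \<open>N\<close>.\<close>
    have "\<forall>\<^sub>F n in sequentially. x / 2 < X n"
      using X(2) x by (intro order_tendstoD) auto
    then obtain N where N: "\<And>n. N \<le> n \<Longrightarrow> x / 2 < X n"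
      by (auto simp: eventually_sequentially)
    have "(\<lambda>n. ?R (X (n + N))) \<longlonglongrightarrow> ?R x"
    proof (rule integral_dominated_convergence[where w = "\<lambda>\<tau>. C / (x / 2) * ?b \<tau>"])
      show "integrable lborel (\<lambda>\<tau>. C / (x / 2) * ?b \<tau>)"
        by (intro integrable_mult_right b_int)
      show "AE \<tau> in lborel. norm (h (X (n + N)) \<tau>) \<le> C / (x / 2) * ?b \<tau>" for n
      proof (intro AE_I2)
        fix \<tau>
        have "h (X (n + N)) \<tau> \<le> C / X (n + N) * ?b \<tau>"
          using X(1) by (intro h_le) auto
        also have "\<dots> \<le> C / (x / 2) * ?b \<tau>"
          using N[of "n + N"] x C nonneg by (intro mult_right_mono divide_left_mono) auto
        finally show "norm (h (X (n + N)) \<tau>) \<le> C / (x / 2) * ?b \<tau>"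
          using h_nonneg by simp
      qed
      show "AE \<tau> in lborel. (\<lambda>n. h (X (n + N)) \<tau>) \<longlonglongrightarrow> h x \<tau>"
      proof (intro AE_I2)
        fix \<tau>
        show "(\<lambda>n. h (X (n + N)) \<tau>) \<longlonglongrightarrow> h x \<tau>"
        proof (cases "0 < \<tau>")
          case True
          have "isCont (?q \<tau>) x"
            using continuous_on_density_at_time[OF Lq True]
            by (simp add: continuous_on_eq_continuous_at)
          then have "(\<lambda>n. ?q \<tau> (X (n + N))) \<longlonglongrightarrow> ?q \<tau> x"
            by (rule isCont_tendsto_compose[OF _ LIMSEQ_ignore_initial_segment[OF X(2)]])
          then show ?thesis
            unfolding h_def by (intro tendsto_mult_left tendsto_mult_right)
        qed (simp add: h_def)
      qed
    qed measurable
    then show "(?R \<circ> X) \<longlonglongrightarrow> ?R x"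
      unfolding comp_def by (rule LIMSEQ_offset)
  qed
  \<comment> \<open>Fubini yields a nonnegative extended integral; integrability of
    \<open>h x\<close> for x > 0 identifies it with the real one.\<close>
  have nn_R: "(\<integral>\<^sup>+\<tau>. ennreal (h x \<tau>) \<partial>lborel) = ennreal (?R x)" if "0 < x" for x
    using h_int[OF that] h_nonneg by (intro nn_integral_eq_integral) auto
  have eq: "(\<integral>\<^sup>+x\<in>A. ennreal (?p x) \<partial>lborel) = (\<integral>\<^sup>+x\<in>A. ennreal (?R x) \<partial>lborel)"
    if A [measurable]: "A \<in> sets borel" and sub: "A \<subseteq> {0<..}" for A
  proof -
    have "(\<integral>\<^sup>+x\<in>A. ennreal (?p x) \<partial>lborel) = emeasure (law_at_time (\<beta> * \<alpha>) (density lborel Lp) t) A"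
      using assms by (subst law_at_time_density) (auto simp: emeasure_density)
    also have "\<dots> = (\<integral>\<^sup>+\<tau>\<in>{0<..}. emeasure (law_at_time \<alpha> (density lborel Lq) \<tau>) A
        \<partial>law_at_time \<beta> (density lborel Lb) t)"
      using assms laws A sub by (intro subordination_emeasure)
    also have "\<dots> = (\<integral>\<^sup>+\<tau>. (\<integral>\<^sup>+x. indicator A x * ennreal (?q \<tau> x) \<partial>lborel) * indicator {0<..} \<tau>
        \<partial>density lborel ?b)"
    proof (subst law_at_time_density)
      show "(\<integral>\<^sup>+\<tau>\<in>{0<..}. emeasure (law_at_time \<alpha> (density lborel Lq) \<tau>) A \<partial>density lborel ?b)
        = (\<integral>\<^sup>+\<tau>. (\<integral>\<^sup>+x. indicator A x * ennreal (?q \<tau> x) \<partial>lborel) * indicator {0<..} \<tau>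
        \<partial>density lborel ?b)"
        by (intro nn_integral_cong)
          (auto simp: indicator_def law_at_time_density emeasure_density mult.commute)
    qed (use assms in auto)
    also have "\<dots> = (\<integral>\<^sup>+\<tau>. ennreal (?b \<tau>) *
        ((\<integral>\<^sup>+x. indicator A x * ennreal (?q \<tau> x) \<partial>lborel) * indicator {0<..} \<tau>) \<partial>lborel)"
      by (subst nn_integral_density) auto
    also have "\<dots> = (\<integral>\<^sup>+\<tau>. (\<integral>\<^sup>+x. ennreal (h x \<tau>) * indicator A x \<partial>lborel) \<partial>lborel)"
    proof (intro nn_integral_cong)
      fix \<tau>
      show "ennreal (?b \<tau>) * ((\<integral>\<^sup>+x. indicator A x * ennreal (?q \<tau> x) \<partial>lborel) * indicator {0<..} \<tau>)
        = (\<integral>\<^sup>+x. ennreal (h x \<tau>) * indicator A x \<partial>lborel)"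
      proof (cases "0 < \<tau>")
        case True
        then have "ennreal (h x \<tau>) * indicator A x = ennreal (?b \<tau>) * (indicator A x * ennreal (?q \<tau> x))" for x
          using nonneg by (simp add: h_def ennreal_mult mult_ac)
        then show ?thesis
          using True by (simp add: nn_integral_cmult)
      qed (simp add: h_def)
    qed
    also have "\<dots> = (\<integral>\<^sup>+x. (\<integral>\<^sup>+\<tau>. ennreal (h x \<tau>) * indicator A x \<partial>lborel) \<partial>lborel)"
      by (intro lborel_pair.Fubini') measurable
    also have "\<dots> = (\<integral>\<^sup>+x\<in>A. ennreal (?R x) \<partial>lborel)"
      using sub nn_R by (intro nn_integral_cong) (auto simp: indicator_def)
    finally show ?thesis .
  qed
  have R_meas [measurable]: "?R \<in> borel_measurable borel"
    by measurable
  \<comment> \<open>\<open>eq\<close> speaks of subsets of \<open>{0<..}\<close>, so both densities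
    are cut off there before uniqueness of densities is applied.\<close>
  have "density lborel (\<lambda>x. ennreal (?p x) * indicator {0<..} x)
      = density lborel (\<lambda>x. ennreal (?R x) * indicator {0<..} x)"
  proof (rule measure_eqI)
    fix A :: "real set" assume "A \<in> sets (density lborel (\<lambda>x. ennreal (?p x) * indicator {0<..} x))"
    then have [measurable]: "A \<in> sets borel" by simp
    show "emeasure (density lborel (\<lambda>x. ennreal (?p x) * indicator {0<..} x)) A
        = emeasure (density lborel (\<lambda>x. ennreal (?R x) * indicator {0<..} x)) A"
      using eq[of "{0<..} \<inter> A"]
      by (auto simp: emeasure_density indicator_inter_arith mult.assoc)
  qed simp
  then have "AE x in lborel. ennreal (?p x) * indicator {0<..} x = ennreal (?R x) * indicator {0<..} x"
    by (intro sigma_finite_measure.density_unique[OF sigma_finite_lborel]) auto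
  then have "AE x in lborel. x \<in> {0<..} \<longrightarrow> ?p x = ?R x"
  proof eventually_elim
    case (elim x)
    then show ?case
      using nonneg(1) Bochner_Integration.integral_nonneg[of lborel "h x", OF h_nonneg]
      by (auto simp: indicator_def)
  qed
  moreover have "continuous_on {0<..} ?p"
    using continuous_on_density_at_time[OF Lp \<open>0 < t\<close>] by (rule continuous_on_subset) simp
  ultimately have "?p x = ?R x"
    using R_cont \<open>0 < x\<close> by (intro AE_eq_continuous_on_imp_eq[of "{0<..}" ?p ?R]) auto
  then show "?p x = (LBINT \<tau>:{0<..}. ?q \<tau> x * ?b \<tau>)"
    by (simp add: set_lebesgue_integral_def h_def)
  show "set_integrable lborel {0<..} (\<lambda>\<tau>. ?q \<tau> x * ?b \<tau>)"
    using h_int[OF \<open>0 < x\<close>] by (simp add: set_integrable_def h_def[abs_def])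
qed

text \<open>The two conjuncts separate the identity of functions from the identity of measures on
  the positive half-line that replaces it when a point mass occurs. Integrability is asserted
  explicitly, since an undefined integral would silently be 0.\<close>

theorem mainTheorem1:
  fixes \<alpha>p \<alpha>q \<beta> \<theta>p \<theta>q :: real
  assumes "feller_parameters \<alpha>p \<theta>p" "feller_parameters \<alpha>q \<theta>q"
    and "0 < \<beta>" "\<beta> \<le> 1"
    and "\<alpha>p = \<beta> * \<alpha>q" "\<theta>p = \<beta> * \<theta>q"
  shows
    "(\<not> dirac_parameters \<alpha>p \<theta>p \<and> \<not> dirac_parameters \<alpha>q \<theta>q \<and> \<not> dirac_parameters \<beta> (- \<beta>) \<longrightarrow>
      (\<forall>Lp Lq Lb. strictly_stable_density \<alpha>p \<theta>p Lp \<longrightarrow> strictly_stable_density \<alpha>q \<theta>q Lq \<longrightarrow>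
        strictly_stable_density \<beta> (- \<beta>) Lb \<longrightarrow>
        (\<forall>x>0. \<forall>t>0.
          set_integrable lborel {0<..}
            (\<lambda>\<tau>. density_at_time \<alpha>q Lq \<tau> x * density_at_time \<beta> Lb t \<tau>) \<and>
          density_at_time \<alpha>p Lp t x =
            (LBINT \<tau>:{0<..}. density_at_time \<alpha>q Lq \<tau> x * density_at_time \<beta> Lb t \<tau>))))
     \<and>
     (dirac_parameters \<alpha>p \<theta>p \<or> dirac_parameters \<alpha>q \<theta>q \<or> dirac_parameters \<beta> (- \<beta>) \<longrightarrow>
      (\<forall>Mp Mq Mb. strictly_stable_law \<alpha>p \<theta>p Mp \<longrightarrow> strictly_stable_law \<alpha>q \<theta>q Mq \<longrightarrow>
        strictly_stable_law \<beta> (- \<beta>) Mb \<longrightarrow>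
        (\<forall>t>0. \<forall>A\<in>sets borel. A \<subseteq> {0<..} \<longrightarrow>
          emeasure (law_at_time \<alpha>p Mp t) A =
            (\<integral>\<^sup>+\<tau>\<in>{0<..}. emeasure (law_at_time \<alpha>q Mq \<tau>) A \<partial>law_at_time \<beta> Mb t))))"
proof (intro conjI impI allI ballI)
  fix Lp Lq Lb and x t :: real
  assume nondirac: "\<not> dirac_parameters \<alpha>p \<theta>p \<and> \<not> dirac_parameters \<alpha>q \<theta>q \<and> \<not> dirac_parameters \<beta> (- \<beta>)"
    and L: "strictly_stable_density \<alpha>p \<theta>p Lp" "strictly_stable_density \<alpha>q \<theta>q Lq"
      "strictly_stable_density \<beta> (- \<beta>) Lb"
    and pos: "0 < x" "0 < t"
  \<comment> \<open>Without a point mass for the outer law, cos (\<theta>q * pi / 2) is positive and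
    the constant of the dominating bound is meaningful.\<close>
  have "\<bar>\<theta>q\<bar> < 1"
    using assms nondirac by (intro feller_abs_less_1) auto
  note subordination =
    subordination_density[OF assms(2) this assms(3,4) L(1)[unfolded assms(5,6)] L(2,3) pos(2,1)]
  show "set_integrable lborel {0<..} (\<lambda>\<tau>. density_at_time \<alpha>q Lq \<tau> x * density_at_time \<beta> Lb t \<tau>)"
    by (rule subordination(1))
  show "density_at_time \<alpha>p Lp t x = (LBINT \<tau>:{0<..}. density_at_time \<alpha>q Lq \<tau> x * density_at_time \<beta> Lb t \<tau>)"
    unfolding assms(5) by (rule subordination(2))
next
  fix Mp Mq Mb and t :: real and A :: "real set"
  assume "strictly_stable_law \<alpha>p \<theta>p Mp" "strictly_stable_law \<alpha>q \<theta>q Mq" "strictly_stable_law \<beta> (- \<beta>) Mb"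
    "0 < t" "A \<in> sets borel" "A \<subseteq> {0<..}"
  then show "emeasure (law_at_time \<alpha>p Mp t) A
      = (\<integral>\<^sup>+\<tau>\<in>{0<..}. emeasure (law_at_time \<alpha>q Mq \<tau>) A \<partial>law_at_time \<beta> Mb t)"
    unfolding assms(5,6) using assms(2-4) by (intro subordination_emeasure)
qed

end
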